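(* Let $\delta=\delta_\varepsilon>0$ be such that $\delta_\varepsilon\to0$ as $\varepsilon\to 0$ and $\lim_{\varepsilon\to 0}\frac{\varepsilon}{\delta_\varepsilon}=0$. Then for every $u\in L^2(\Omega)$ there exists a family $u_\varepsilon\in L^2(\Omega)$ converging to $u$ strongly in $L^2(\Omega)$ as $\varepsilon\to0$ and such that $$\lim_{\varepsilon\to 0}F_{\delta_\varepsilon,\varepsilon}(u_\varepsilon)=0 .$$
   Context: Kernel: $\varphi:\mathbb R^d\to[0,+\infty)$ is radial and decreasing, i.e. $\varphi(\xi)=\varphi_0(|\xi|)$ with $\varphi_0:[0,+\infty)\to[0,+\infty)$ decreasing (non-increasing), and $\int_{\mathbb R^d}\varphi(\xi)(1+|\xi|^2)\,d\xi<+\infty$. For $\varepsilon>0$ set $\varphi_\varepsilon(\xi)=\varepsilon^{-d}\varphi(\xi/\varepsilon)$. Geometry: $\Omega\subset\mathbb R^d$ is a bounded domain with Lipschitz boundary. $K\subset\mathbb R^d$ is a compact set which is the closure of a nonempty connected open set, has boundary of zero Lebesgue measure, and satisfies $(k+K)\cap K=\emptyset$ for all $k\in\mathbb Z^d\setminus\{0\}$. Set $E=\bigcup_{k\in\mathbb Z^d}(k+K)$. Functional: for $\varepsilon,\delta>0$ and $u\in L^2(\Omega)$, $$F_{\delta,\varepsilon}(u)=\frac1{\varepsilon^2}\int_{(\Omega\cap\delta E)\times(\Omega\cap\delta E)}\varphi_\varepsilon(x-y)\,|u(x)-u(y)|^2\,dx\,dy .$$ *)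

theory Defs
  imports "HOL-Analysis.Analysis"
begin

definition radial_decreasing_kernel :: "(real ^ 'n \<Rightarrow> real) \<Rightarrow> bool" where
  "radial_decreasing_kernel \<phi> \<longleftrightarrow>
     (\<exists>\<phi>0 :: real \<Rightarrow> real.
        (\<forall>r\<ge>0. 0 \<le> \<phi>0 r) \<and> antimono_on {0..} \<phi>0 \<and> (\<forall>\<xi>. \<phi> \<xi> = \<phi>0 (norm \<xi>)))
     \<and> integrable lebesgue (\<lambda>\<xi>. \<phi> \<xi> * (1 + (norm \<xi>)\<^sup>2))"

definition scaled_kernel :: "(real ^ 'n \<Rightarrow> real) \<Rightarrow> real \<Rightarrow> real ^ 'n \<Rightarrow> real" where
  "scaled_kernel \<phi> \<epsilon> \<xi> = (1 / \<epsilon> ^ CARD('n)) * \<phi> ((1 / \<epsilon>) *\<^sub>R \<xi>)"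

text \<open>Near each boundary point the set is a strict subgraph, in some unit direction \<open>v\<close>, of a
  Lipschitz function \<open>g\<close> on the hyperplane orthogonal to \<open>v\<close>. Since \<open>U\<close> is open, this forces the
  boundary inside \<open>U\<close> to be exactly the graph of \<open>g\<close>.\<close>

definition lipschitz_boundary :: "(real ^ 'n) set \<Rightarrow> bool" where
  "lipschitz_boundary \<Omega> \<longleftrightarrow>
     (\<forall>p \<in> frontier \<Omega>. \<exists>U v g L.
        open U \<and> p \<in> U \<and> norm v = 1 \<and> L-lipschitz_on {z. z \<bullet> v = 0} g \<and>
        \<Omega> \<inter> U = {x \<in> U. x \<bullet> v < g (x - (x \<bullet> v) *\<^sub>R v)})"

definition bounded_lipschitz_domain :: "(real ^ 'n) set \<Rightarrow> bool" where
  "bounded_lipschitz_domain \<Omega> \<longleftrightarrow>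
     open \<Omega> \<and> connected \<Omega> \<and> \<Omega> \<noteq> {} \<and> bounded \<Omega> \<and> lipschitz_boundary \<Omega>"

definition int_lattice :: "(real ^ 'n) set" where
  "int_lattice = {k. \<forall>i. k $ i \<in> \<int>}"

definition admissible_inclusion :: "(real ^ 'n) set \<Rightarrow> bool" where
  "admissible_inclusion K \<longleftrightarrow>
     compact K \<and>
     (\<exists>G. open G \<and> connected G \<and> G \<noteq> {} \<and> K = closure G) \<and>
     frontier K \<in> null_sets lebesgue \<and>
     (\<forall>k \<in> int_lattice - {0}. ((+) k ` K) \<inter> K = {})"

definition periodic_union :: "(real ^ 'n) set \<Rightarrow> (real ^ 'n) set" where
  "periodic_union K = (\<Union>k \<in> int_lattice. (+) k ` K)"

text \<open>Elements of \<open>L\<^sup>2(\<Omega>)\<close> are represented by functions on the whole space, of which only the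
  values on \<open>\<Omega>\<close> matter.\<close>

definition L2_on :: "(real ^ 'n) set \<Rightarrow> (real ^ 'n \<Rightarrow> real) \<Rightarrow> bool" where
  "L2_on \<Omega> u \<longleftrightarrow>
     set_borel_measurable lebesgue \<Omega> u \<and> set_integrable lebesgue \<Omega> (\<lambda>x. (u x)\<^sup>2)"

definition L2_dist_on ::
    "(real ^ 'n) set \<Rightarrow> (real ^ 'n \<Rightarrow> real) \<Rightarrow> (real ^ 'n \<Rightarrow> real) \<Rightarrow> real" where
  "L2_dist_on \<Omega> u v = sqrt (LINT x:\<Omega>|lebesgue. (u x - v x)\<^sup>2)"

text \<open>The energy is an extended nonnegative integral, so it carries no convention for divergent
  integrals.\<close>

definition energy ::
    "(real ^ 'n \<Rightarrow> real) \<Rightarrow> (real ^ 'n) set \<Rightarrow> (real ^ 'n) set \<Rightarrow> real \<Rightarrow> real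
      \<Rightarrow> (real ^ 'n \<Rightarrow> real) \<Rightarrow> ennreal" where
  "energy \<phi> \<Omega> E \<delta> \<epsilon> u =
     ennreal (1 / \<epsilon>\<^sup>2) *
     (\<integral>\<^sup>+ (x, y) \<in> (\<Omega> \<inter> (*\<^sub>R) \<delta> ` E) \<times> (\<Omega> \<inter> (*\<^sub>R) \<delta> ` E).
        ennreal (scaled_kernel \<phi> \<epsilon> (x - y) * \<bar>u x - u y\<bar>\<^sup>2) \<partial>(lebesgue \<Otimes>\<^sub>M lebesgue))"

end

theory Submission
  imports Defs
begin

text \<open>The energy sees a function only on the inclusions \<open>\<delta>(k + K)\<close>, and a function that is constant on
  each of them pays nothing for pairs of points in the same inclusion. Points of two different
  inclusions are at distance at least \<open>\<delta>r\<close>, where \<open>r > 0\<close> is a lower bound for the distance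
  between distinct integer translates of the compact set \<open>K\<close>; since \<open>\<delta>\<close> is much larger than the
  range \<open>\<epsilon>\<close> of the kernel, the kernel is almost blind to such pairs.

  To make this quantitative, let \<open>w\<close> be a bounded Lipschitz function and replace it on
  \<open>\<delta>(k + K)\<close> by the single value \<open>w (\<delta>k)\<close>. This moves \<open>w\<close> by \<open>O(\<delta>)\<close> uniformly
  (\<open>cellwise_constant_close\<close>). The new function \<open>v\<close> jumps between different inclusions, but because
  these are \<open>\<delta>r\<close> apart the shift of order \<open>\<delta>\<close> of the sampling points is absorbed in
  \<open>|x - y|\<close>, so that still \<open>|v x - v y| \<le> C |x - y|\<close> with \<open>C\<close> free of \<open>\<delta>\<close>
  (\<open>cellwise_constant_increment\<close>). Substituting \<open>x - y = \<epsilon>\<eta>\<close> in the energy cancels the factor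
  \<open>1 / \<epsilon>\<^sup>2\<close> and bounds it by \<open>C\<^sup>2 |\<Omega>|\<close> times the integral of \<open>\<phi> \<eta> |\<eta>|\<^sup>2\<close> over
  \<open>|\<eta>| \<ge> r\<delta> / \<epsilon>\<close> (\<open>energy_le_second_moment_tail\<close>). This is a tail of a convergent integral and
  \<open>r\<delta> / \<epsilon> \<rightarrow> \<infinity>\<close>, so it tends to zero.

  A general \<open>u\<close> is approximated in \<open>L\<^sup>2(\<Omega>)\<close> by bounded Lipschitz functions
  (\<open>bounded_lipschitz_dense\<close>). For each \<open>e > 0\<close> some competitor thus has distance to \<open>u\<close> plus energy
  below \<open>e\<close> once \<open>\<epsilon>\<close> is small, which says that the infimum of this sum over all competitors
  tends to zero. Choosing for each \<open>\<epsilon>\<close> a competitor within \<open>\<epsilon>\<close> of the infimum gives the family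
  (\<open>near_minimizers_tendsto_zero\<close>) and takes the place of a diagonal argument.\<close>

section \<open>Squared distance in mean\<close>

text \<open>The value is an extended nonnegative number: it can then be compared and added without
  integrability conditions, and added to the energy.\<close>

definition sq_dist :: "'a::euclidean_space set \<Rightarrow> ('a \<Rightarrow> real) \<Rightarrow> ('a \<Rightarrow> real) \<Rightarrow> ennreal" where
  "sq_dist S f g = (\<integral>\<^sup>+ x\<in>S. ennreal ((f x - g x)\<^sup>2) \<partial>lebesgue)"

lemma sq_dist_cong:
  assumes "\<And>x. x \<in> S \<Longrightarrow> f x = f' x" "\<And>x. x \<in> S \<Longrightarrow> g x = g' x"
  shows "sq_dist S f g = sq_dist S f' g'"
  unfolding sq_dist_def using assms
  by (intro nn_integral_cong) (auto split: split_indicator)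

text \<open>Squares satisfy the triangle inequality only up to the factor \<open>2\<close>, from
  \<open>(a + b)\<^sup>2 \<le> 2a\<^sup>2 + 2b\<^sup>2\<close>; this is enough for approximation in several steps and avoids Minkowski's
  inequality.\<close>

lemma sq_dist_triangle:
  assumes [measurable]: "f \<in> borel_measurable lebesgue" "g \<in> borel_measurable lebesgue"
    "h \<in> borel_measurable lebesgue" "S \<in> sets lebesgue"
  shows "sq_dist S f h \<le> 2 * sq_dist S f g + 2 * sq_dist S g h"
proof -
  have sq: "(f x - h x)\<^sup>2 \<le> 2 * (f x - g x)\<^sup>2 + 2 * (g x - h x)\<^sup>2" for x
    using zero_le_power2[of "(f x - g x) - (g x - h x)"]
    by (simp add: power2_eq_square algebra_simps)
  then have le: "ennreal ((f x - h x)\<^sup>2) \<le> 2 * ennreal ((f x - g x)\<^sup>2) + 2 * ennreal ((g x - h x)\<^sup>2)" for x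
    using ennreal_leI[OF sq, of x] by (simp add: ennreal_plus ennreal_mult)
  have "sq_dist S f h \<le> (\<integral>\<^sup>+ x. 2 * (ennreal ((f x - g x)\<^sup>2) * indicator S x)
      + 2 * (ennreal ((g x - h x)\<^sup>2) * indicator S x) \<partial>lebesgue)"
    unfolding sq_dist_def using le by (intro nn_integral_mono) (auto split: split_indicator)
  also have "\<dots> = 2 * sq_dist S f g + 2 * sq_dist S g h"
    unfolding sq_dist_def by (subst nn_integral_add) (auto simp: nn_integral_cmult)
  finally show ?thesis .
qed

lemma sq_dist_le_uniform:
  assumes "S \<in> sets lebesgue" "\<And>x. x \<in> S \<Longrightarrow> \<bar>f x - g x\<bar> \<le> c"
  shows "sq_dist S f g \<le> ennreal (c\<^sup>2) * emeasure lebesgue S"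
proof -
  have "sq_dist S f g \<le> (\<integral>\<^sup>+ x\<in>S. ennreal (c\<^sup>2) \<partial>lebesgue)"
    unfolding sq_dist_def using assms(2)
    by (intro nn_integral_mono) (auto split: split_indicator intro!: ennreal_leI simp: abs_le_square_iff[symmetric] order_trans[OF _ abs_ge_self])
  then show ?thesis
    using assms(1) by (simp add: nn_integral_cmult_indicator)
qed

lemma sq_dist_tendsto_zero:
  assumes [measurable]: "\<And>n. F n \<in> borel_measurable lebesgue" "f \<in> borel_measurable lebesgue"
      "W \<in> borel_measurable lebesgue" "S \<in> sets lebesgue"
    and bound: "\<And>n x. x \<in> S \<Longrightarrow> (F n x - f x)\<^sup>2 \<le> W x"
    and fin: "(\<integral>\<^sup>+ x\<in>S. ennreal (W x) \<partial>lebesgue) < \<infinity>"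
    and lim: "AE x in lebesgue. (\<lambda>n. F n x) \<longlonglongrightarrow> f x"
  shows "(\<lambda>n. sq_dist S (F n) f) \<longlonglongrightarrow> 0"
proof -
  have "(\<lambda>n. \<integral>\<^sup>+ x. ennreal ((F n x - f x)\<^sup>2) * indicator S x \<partial>lebesgue)
      \<longlonglongrightarrow> (\<integral>\<^sup>+ x. 0 \<partial>(lebesgue :: 'a measure))"
  proof (rule nn_integral_dominated_convergence[where w = "\<lambda>x. ennreal (W x) * indicator S x"])
    show "AE x in lebesgue. (\<lambda>n. ennreal ((F n x - f x)\<^sup>2) * indicator S x) \<longlonglongrightarrow> 0"
      using lim
    proof eventually_elim
      fix x assume "(\<lambda>n. F n x) \<longlonglongrightarrow> f x"
      then have "(\<lambda>n. (F n x - f x)\<^sup>2) \<longlonglongrightarrow> (f x - f x)\<^sup>2"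
        by (intro tendsto_intros)
      then have "(\<lambda>n. ennreal ((F n x - f x)\<^sup>2)) \<longlonglongrightarrow> ennreal ((f x - f x)\<^sup>2)"
        by (intro tendsto_ennrealI)
      then show "(\<lambda>n. ennreal ((F n x - f x)\<^sup>2) * indicator S x) \<longlonglongrightarrow> 0"
        by (cases "x \<in> S") auto
    qed
  qed (use bound fin in \<open>auto split: split_indicator intro!: ennreal_leI\<close>)
  then show ?thesis
    by (simp add: sq_dist_def)
qed

section \<open>Bounded Lipschitz functions are dense\<close>

definition bounded_lipschitz :: "('a::metric_space \<Rightarrow> real) \<Rightarrow> bool" where
  "bounded_lipschitz w \<longleftrightarrow> bounded (range w) \<and> (\<exists>L. L-lipschitz_on UNIV w)"

lemma bounded_lipschitz_add:
  assumes "bounded_lipschitz f" "bounded_lipschitz g"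
  shows "bounded_lipschitz (\<lambda>x. f x + g x)"
  using assms unfolding bounded_lipschitz_def
  by (auto intro!: lipschitz_intros bounded_plus_comp)

text \<open>Boundedness is what makes Lipschitz functions closed under products, hence a ring to which the
  Stone--Weierstrass theorem applies.\<close>

lemma bounded_lipschitz_mult:
  assumes "bounded_lipschitz f" "bounded_lipschitz g"
  shows "bounded_lipschitz (\<lambda>x. f x * g x)"
proof -
  obtain A B where A: "\<And>x. \<bar>f x\<bar> \<le> A" and B: "\<And>x. \<bar>g x\<bar> \<le> B"
    using assms unfolding bounded_lipschitz_def bounded_iff by auto
  obtain L M where L: "L-lipschitz_on UNIV f" and M: "M-lipschitz_on UNIV g"
    using assms unfolding bounded_lipschitz_def by auto
  have nn: "0 \<le> A" "0 \<le> B" "0 \<le> L" "0 \<le> M"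
    using A B L M by (auto simp: lipschitz_on_nonneg intro: order_trans[OF abs_ge_zero])
  have "(A * M + L * B)-lipschitz_on UNIV (\<lambda>x. f x * g x)"
  proof (rule lipschitz_onI)
    fix x y
    have "\<bar>f x * g x - f y * g y\<bar> = \<bar>f x * (g x - g y) + (f x - f y) * g y\<bar>"
      by (simp add: algebra_simps)
    also have "\<dots> \<le> \<bar>f x\<bar> * \<bar>g x - g y\<bar> + \<bar>f x - f y\<bar> * \<bar>g y\<bar>"
      by (metis abs_mult abs_triangle_ineq)
    also have "\<dots> \<le> A * (M * dist x y) + (L * dist x y) * B"
      using A B lipschitz_onD[OF L, of x y] lipschitz_onD[OF M, of x y] nn
      by (intro add_mono mult_mono) (auto simp: dist_real_def)
    finally show "dist (f x * g x) (f y * g y) \<le> (A * M + L * B) * dist x y"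
      by (simp add: dist_real_def algebra_simps)
  qed (use nn in auto)
  moreover have "\<bar>f x * g x\<bar> \<le> A * B" for x
    using A B nn by (auto simp: abs_mult intro!: mult_mono)
  ultimately show ?thesis
    unfolding bounded_lipschitz_def bounded_iff by auto
qed

text \<open>These functions separate points; the truncation keeps them bounded.\<close>

lemma bounded_lipschitz_truncated_dist: "bounded_lipschitz (\<lambda>z. min 1 (dist x z))"
proof -
  have "1-lipschitz_on UNIV (\<lambda>z. min 1 (dist x z))"
  proof (rule lipschitz_onI)
    fix y z
    show "dist (min 1 (dist x y)) (min 1 (dist x z)) \<le> 1 * dist y z"
      using dist_triangle[of x y z] dist_triangle[of x z y]
      by (auto simp: dist_real_def min_def dist_commute abs_if)
  qed simp
  moreover have "bounded (range (\<lambda>z. min 1 (dist x z)))"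
    unfolding bounded_iff by (auto intro!: exI[of _ 1])
  ultimately show ?thesis
    unfolding bounded_lipschitz_def by auto
qed

lemma bounded_lipschitz_uniform_approx:
  fixes g :: "'a::metric_space \<Rightarrow> real"
  assumes "compact S" "continuous_on S g" "e > 0"
  obtains w where "bounded_lipschitz w" "\<And>x. x \<in> S \<Longrightarrow> \<bar>g x - w x\<bar> < e"
proof -
  have "\<exists>w. bounded_lipschitz w \<and> (\<forall>x\<in>S. \<bar>g x - w x\<bar> < e)"
  proof (rule Stone_Weierstrass_HOL)
    show "bounded_lipschitz (\<lambda>x::'a. c)" for c
      unfolding bounded_lipschitz_def by (auto intro: lipschitz_intros)
    show "continuous_on S f" if "bounded_lipschitz f" for f
      using that unfolding bounded_lipschitz_def
      by (meson continuous_on_subset lipschitz_on_continuous_on subset_UNIV)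
    show "\<exists>f. bounded_lipschitz f \<and> f x \<noteq> f y" if "x \<in> S \<and> y \<in> S \<and> x \<noteq> y" for x y
      using that by (intro exI[of _ "\<lambda>z. min 1 (dist x z)"] conjI bounded_lipschitz_truncated_dist) (simp add: min_def)
  qed (use assms in \<open>auto intro: bounded_lipschitz_add bounded_lipschitz_mult\<close>)
  then show ?thesis
    using that by blast
qed

lemma bounded_lipschitz_borel: "bounded_lipschitz w \<Longrightarrow> w \<in> borel_measurable borel"
  unfolding bounded_lipschitz_def
  by (auto intro: borel_measurable_continuous_onI lipschitz_on_continuous_on)

text \<open>A measurable function is an almost everywhere limit of continuous ones. Clipping these at a
  bound of the limit keeps the convergence and supplies the constant majorant that dominated
  convergence needs on a set of finite measure.\<close>

lemma continuous_approx_of_bounded_measurable: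
  fixes f :: "'a::euclidean_space \<Rightarrow> real"
  assumes [measurable]: "f \<in> borel_measurable lebesgue" "S \<in> sets lebesgue"
    and fin: "emeasure lebesgue S < \<infinity>" and M: "\<And>x. \<bar>f x\<bar> \<le> M" and "e > 0"
  obtains g where "continuous_on UNIV g" "sq_dist S g f < e"
proof -
  have "f measurable_on UNIV"
    by (rule lebesgue_measurable_imp_measurable_on) auto
  then obtain N G where N: "negligible N" and G: "\<And>n. continuous_on UNIV (G n)"
    and lim: "\<And>x. x \<notin> N \<Longrightarrow> (\<lambda>n. G n x) \<longlonglongrightarrow> f x"
    unfolding measurable_on_def by auto
  define F where "F n x = max (-M) (min M (G n x))" for n :: nat and x
  have cont: "continuous_on UNIV (F n)" for n
    unfolding F_def using G by (intro continuous_intros)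
  have "(\<lambda>n. sq_dist S (F n) f) \<longlonglongrightarrow> 0"
  proof (rule sq_dist_tendsto_zero[where W = "\<lambda>_. (2 * M)\<^sup>2"])
    show "F n \<in> borel_measurable lebesgue" for n
      using borel_measurable_continuous_onI[OF cont[of n]] by (simp add: measurable_completion)
    show "(F n x - f x)\<^sup>2 \<le> (2 * M)\<^sup>2" for n x
      using M[of x] unfolding F_def by (intro abs_le_square_iff[THEN iffD1]) auto
    have "(\<lambda>n. F n x) \<longlonglongrightarrow> f x" if "x \<notin> N" for x
    proof -
      have "(\<lambda>n. F n x) \<longlonglongrightarrow> max (-M) (min M (f x))"
        unfolding F_def using lim[OF that] by (intro tendsto_intros)
      moreover have "max (-M) (min M (f x)) = f x"
        using M[of x] by auto
      ultimately show ?thesis by simp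
    qed
    then show "AE x in lebesgue. (\<lambda>n. F n x) \<longlonglongrightarrow> f x"
      using N by (intro AE_I'[of N]) (auto simp: negligible_iff_null_sets)
    show "(\<integral>\<^sup>+ x\<in>S. ennreal ((2 * M)\<^sup>2) \<partial>lebesgue) < \<infinity>"
      using fin by (simp add: nn_integral_cmult_indicator ennreal_mult_less_top)
  qed auto
  then have "eventually (\<lambda>n. sq_dist S (F n) f < e) sequentially"
    using \<open>e > 0\<close> by (rule order_tendstoD)
  then obtain n where "sq_dist S (F n) f < e"
    by (auto simp: eventually_sequentially)
  then show ?thesis
    using that cont by blast
qed

text \<open>The truncations at height \<open>n\<close> differ from \<open>f\<close> by at most \<open>|f|\<close>, so \<open>f\<^sup>2\<close> is a majorant.\<close>

lemma bounded_truncation_approx: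
  fixes f :: "'a::euclidean_space \<Rightarrow> real"
  assumes [measurable]: "f \<in> borel_measurable lebesgue" "S \<in> sets lebesgue"
    and fin: "(\<integral>\<^sup>+ x\<in>S. ennreal ((f x)\<^sup>2) \<partial>lebesgue) < \<infinity>" and "e > 0"
  obtains h M where "h \<in> borel_measurable lebesgue" "\<And>x. \<bar>h x\<bar> \<le> M" "sq_dist S h f < e"
proof -
  define F where "F n x = max (- real n) (min (real n) (f x))" for n x
  have [measurable]: "F n \<in> borel_measurable lebesgue" for n
    unfolding F_def by measurable
  have "(\<lambda>n. sq_dist S (F n) f) \<longlonglongrightarrow> 0"
  proof (rule sq_dist_tendsto_zero[where W = "\<lambda>x. (f x)\<^sup>2"])
    show "(F n x - f x)\<^sup>2 \<le> (f x)\<^sup>2" for n x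
      unfolding F_def by (intro abs_le_square_iff[THEN iffD1]) auto
    have "(\<lambda>n. F n x) \<longlonglongrightarrow> f x" for x
    proof (rule tendsto_eventually)
      obtain N where "\<bar>f x\<bar> \<le> real N"
        using real_arch_simple by blast
      then show "eventually (\<lambda>n. F n x = f x) sequentially"
        unfolding F_def by (intro eventually_sequentiallyI[of N]) auto
    qed
    then show "AE x in lebesgue. (\<lambda>n. F n x) \<longlonglongrightarrow> f x"
      by auto
  qed (use fin in auto)
  then have "eventually (\<lambda>n. sq_dist S (F n) f < e) sequentially"
    using \<open>e > 0\<close> by (rule order_tendstoD)
  then obtain n where "sq_dist S (F n) f < e"
    by (auto simp: eventually_sequentially)
  moreover have "\<bar>F n x\<bar> \<le> real n" for x
    unfolding F_def by auto
  ultimately show ?thesis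
    using that[of "F n" "real n"] by auto
qed

text \<open>Three approximations in a row: truncate, pass to a continuous function, then to a bounded
  Lipschitz function that is uniformly close on the compact closure of \<open>S\<close>.\<close>

lemma bounded_lipschitz_dense:
  fixes f :: "'a::euclidean_space \<Rightarrow> real"
  assumes f [measurable]: "f \<in> borel_measurable lebesgue" and S [measurable]: "S \<in> sets lebesgue"
    and "bounded S" and fin: "(\<integral>\<^sup>+ x\<in>S. ennreal ((f x)\<^sup>2) \<partial>lebesgue) < \<infinity>" and "e > (0::real)"
  obtains w where "bounded_lipschitz w" "sq_dist S w f < e"
proof -
  have finS: "emeasure lebesgue S < \<infinity>"
    using bounded_set_imp_lmeasurable[OF \<open>bounded S\<close> S] by (simp add: fmeasurable_def)
  obtain h M where h [measurable]: "h \<in> borel_measurable lebesgue" and M: "\<And>x. \<bar>h x\<bar> \<le> M"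
    and h_f: "sq_dist S h f < ennreal (e / 8)"
    using bounded_truncation_approx[OF f S fin, of "ennreal (e / 8)"] \<open>e > 0\<close> by auto
  obtain g where g: "continuous_on UNIV g" and g_h: "sq_dist S g h < ennreal (e / 16)"
    using continuous_approx_of_bounded_measurable[OF h S finS M, of "ennreal (e / 16)"] \<open>e > 0\<close> by auto
  define m where "m = measure lebesgue S"
  have m: "emeasure lebesgue S = ennreal m" "0 \<le> m"
    using finS unfolding m_def by (auto simp: emeasure_eq_ennreal_measure)
  \<comment> \<open>With this tolerance the uniform approximation costs \<open>c\<^sup>2 m < e / 16\<close>; the \<open>+ 1\<close> covers \<open>m = 0\<close>.\<close>
  define c where "c = sqrt (e / (16 * (m + 1)))"
  have "c > 0"
    unfolding c_def using \<open>e > 0\<close> m by simp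
  have "c\<^sup>2 * m < e / 16"
    unfolding c_def using \<open>e > 0\<close> m by (simp add: field_simps)
  obtain w where w: "bounded_lipschitz w" and w_g: "\<And>x. x \<in> closure S \<Longrightarrow> \<bar>g x - w x\<bar> < c"
    using bounded_lipschitz_uniform_approx[of "closure S" g c] \<open>bounded S\<close> \<open>c > 0\<close>
      continuous_on_subset[OF g subset_UNIV] by (metis compact_closure)
  have [measurable]: "w \<in> borel_measurable lebesgue" "g \<in> borel_measurable lebesgue"
    using bounded_lipschitz_borel[OF w] borel_measurable_continuous_onI[OF g]
    by (simp_all add: measurable_completion)
  have "sq_dist S w g \<le> ennreal (c\<^sup>2) * emeasure lebesgue S"
    using w_g closure_subset[of S] by (intro sq_dist_le_uniform) (force simp: abs_minus_commute)+
  also have "\<dots> < ennreal (e / 16)"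
    using \<open>c\<^sup>2 * m < e / 16\<close> m by (simp add: ennreal_mult'[symmetric] ennreal_lessI \<open>e > 0\<close>)
  finally have w_g': "sq_dist S w g \<le> ennreal (e / 16)"
    by simp
  have double: "2 * ennreal a + 2 * ennreal b = ennreal (2 * a + 2 * b)" if "0 \<le> a" "0 \<le> b" for a b
    using that by (simp add: ennreal_plus ennreal_mult)
  have "sq_dist S w h \<le> 2 * sq_dist S w g + 2 * sq_dist S g h"
    by (rule sq_dist_triangle) auto
  also have "\<dots> \<le> 2 * ennreal (e / 16) + 2 * ennreal (e / 16)"
    using w_g' g_h by (intro add_mono mult_left_mono) auto
  also have "\<dots> = ennreal (e / 4)"
    using \<open>e > 0\<close> by (subst double) auto
  finally have w_h: "sq_dist S w h \<le> ennreal (e / 4)" .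
  have "sq_dist S w f \<le> 2 * sq_dist S w h + 2 * sq_dist S h f"
    by (rule sq_dist_triangle) auto
  also have "\<dots> \<le> 2 * ennreal (e / 4) + 2 * ennreal (e / 8)"
    using w_h h_f by (intro add_mono mult_left_mono) auto
  also have "\<dots> = ennreal (3 * e / 4)"
    using \<open>e > 0\<close> by (subst double) auto
  also have "\<dots> < ennreal e"
    using \<open>e > 0\<close> by (simp add: ennreal_lessI)
  finally show ?thesis
    using that w by blast
qed


section \<open>The cells of a periodic arrangement\<close>

text \<open>Off the periodic set the value is the point itself, so that sampling a function at the cell index
  changes it only on the inclusions.\<close>

definition cell_index :: "(real ^ 'n) set \<Rightarrow> real ^ 'n \<Rightarrow> real ^ 'n" where
  "cell_index K x = (if x \<in> periodic_union K then SOME k. k \<in> int_lattice \<and> x - k \<in> K else x)"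

lemma mem_periodic_union: "x \<in> periodic_union K \<longleftrightarrow> (\<exists>k\<in>int_lattice. x - k \<in> K)"
  unfolding periodic_union_def by (force simp: image_iff algebra_simps)

lemma int_lattice_diff: "k \<in> int_lattice \<Longrightarrow> l \<in> int_lattice \<Longrightarrow> k - l \<in> int_lattice"
  by (auto simp: int_lattice_def)

text \<open>Two candidates \<open>k\<close> and \<open>l\<close> would put a point into both \<open>K\<close> and its translate by the nonzero
  lattice vector \<open>l - k\<close>, and these are disjoint.\<close>

lemma cell_index_unique:
  assumes "admissible_inclusion K" "k \<in> int_lattice" "x - k \<in> K"
  shows "cell_index K x = k"
proof -
  have "l = k" if l: "l \<in> int_lattice" "x - l \<in> K" for l
  proof (rule ccontr)
    assume "l \<noteq> k"
    then have "l - k \<in> int_lattice - {0}"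
      using assms(2) l by (auto intro: int_lattice_diff)
    then have "((+) (l - k) ` K) \<inter> K = {}"
      using assms(1) unfolding admissible_inclusion_def by blast
    moreover have "x - k = (l - k) + (x - l)"
      by simp
    ultimately show False
      using assms(3) l(2) by blast
  qed
  then have "(SOME k. k \<in> int_lattice \<and> x - k \<in> K) = k"
    using assms by (blast intro: some_equality)
  then show ?thesis
    using assms unfolding cell_index_def mem_periodic_union by auto
qed

lemma countable_int_lattice: "countable (int_lattice :: (real ^ 'n) set)"
proof -
  have "(int_lattice :: (real ^ 'n) set) \<subseteq> range (\<lambda>m :: int ^ 'n. \<chi> i. real_of_int (m $ i))"
  proof
    fix k :: "real ^ 'n" assume "k \<in> int_lattice"
    then have "k = (\<chi> i. real_of_int ((\<chi> j. \<lfloor>k $ j\<rfloor>) $ i))"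
      by (auto simp: int_lattice_def vec_eq_iff)
    then show "k \<in> range (\<lambda>m :: int ^ 'n. \<chi> i. real_of_int (m $ i))"
      by blast
  qed
  then show ?thesis
    by (rule countable_subset) auto
qed

text \<open>The space splits into countably many Borel pieces, the closed translates of \<open>K\<close> and the
  complement of their union. The map is constant on each translate and the identity on the complement.\<close>

lemma borel_measurable_cell_index:
  fixes K :: "(real ^ 'n) set"
  assumes K: "admissible_inclusion K"
  shows "cell_index K \<in> borel_measurable borel"
proof -
  have closed: "closed ((+) k ` K)" for k
    using K unfolding admissible_inclusion_def by (auto intro: compact_imp_closed closed_translation)
  have union: "periodic_union K \<in> sets borel"
    unfolding periodic_union_def
    using closed by (intro sets.countable_UN' countable_int_lattice) auto
  let ?C = "insert (- periodic_union K) ((\<lambda>k. (+) k ` K) ` int_lattice)"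
  show ?thesis
  proof (rule measurable_piecewise_restrict[where C = ?C])
    show "countable ?C"
      by (simp add: countable_int_lattice)
    show "A \<inter> space borel \<in> sets borel" if "A \<in> ?C" for A
      using that union closed by auto
    show "space borel \<subseteq> \<Union>?C"
      by (auto simp: periodic_union_def)
    show "cell_index K \<in> borel_measurable (restrict_space borel A)" if "A \<in> ?C" for A
      using that
    proof (elim insertE imageE)
      assume A: "A = - periodic_union K"
      have "cell_index K \<in> borel_measurable (restrict_space borel A)
          \<longleftrightarrow> (\<lambda>x. x) \<in> borel_measurable (restrict_space borel A)"
        by (rule measurable_cong) (auto simp: A cell_index_def space_restrict_space)
      then show ?thesis
        by (simp add: measurable_restrict_space1)
    next
      fix k :: "real ^ 'n" assume A: "A = (+) k ` K" and k: "k \<in> int_lattice"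
      have "cell_index K \<in> borel_measurable (restrict_space borel A)
          \<longleftrightarrow> (\<lambda>_. k) \<in> borel_measurable (restrict_space borel A)"
        by (rule measurable_cong) (auto simp: A space_restrict_space intro!: cell_index_unique K k)
      then show ?thesis
        by simp
    qed
  qed
qed

text \<open>The differences of points of \<open>K\<close> form a compact set. Disjointness of the translates says that it
  misses the nonzero lattice vectors, which form a closed set because they are discrete. A compact set
  and a closed set that are disjoint have positive distance.\<close>

lemma cells_separated:
  fixes K :: "(real ^ 'n) set"
  assumes K: "admissible_inclusion K"
  obtains r where "r > 0"
    "\<And>k x y. k \<in> int_lattice \<Longrightarrow> k \<noteq> 0 \<Longrightarrow> x \<in> K \<Longrightarrow> y \<in> K \<Longrightarrow> r \<le> norm (k + x - y)"
proof -
  have "compact K" and disj: "\<And>k. k \<in> int_lattice - {0} \<Longrightarrow> ((+) k ` K) \<inter> K = {}"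
    using K unfolding admissible_inclusion_def by auto
  have "closed (int_lattice - {0} :: (real ^ 'n) set)"
  proof (rule discrete_imp_closed[of 1], simp, intro ballI impI)
    fix k l :: "real ^ 'n"
    assume kl: "k \<in> int_lattice - {0}" "l \<in> int_lattice - {0}" "dist l k < 1"
    have "l $ i = k $ i" for i
    proof -
      have "\<bar>(l - k) $ i\<bar> < 1"
        using component_le_norm_cart[of "l - k" i] kl(3) by (simp add: dist_norm)
      moreover have "(l - k) $ i \<in> \<int>"
        using kl by (simp add: int_lattice_def)
      ultimately have "(l - k) $ i = 0"
        using Ints_nonzero_abs_less1 by blast
      then show ?thesis by simp
    qed
    then show "l = k"
      by (simp add: vec_eq_iff)
  qed
  moreover have "compact {y - x |x y. x \<in> K \<and> y \<in> K}"
    using compact_differences[OF \<open>compact K\<close> \<open>compact K\<close>] by (rule back_subst) auto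
  moreover have "{y - x |x y. x \<in> K \<and> y \<in> K} \<inter> (int_lattice - {0}) = {}"
  proof -
    have False if "x \<in> K" "y \<in> K" "y - x \<in> int_lattice - {0}" for x y
      using disj[OF that(3)] that(1,2) by (auto simp: image_iff disjoint_iff)
    then show ?thesis by blast
  qed
  ultimately have "\<exists>r>0. \<forall>d\<in>{y - x |x y. x \<in> K \<and> y \<in> K}. \<forall>k\<in>int_lattice - {0}. r \<le> dist d k"
    by (intro separate_compact_closed)
  then obtain r where r: "r > 0"
    "\<And>d k. d \<in> {y - x |x y. x \<in> K \<and> y \<in> K} \<Longrightarrow> k \<in> int_lattice - {0} \<Longrightarrow> r \<le> dist d k"
    by blast
  show ?thesis
  proof (rule that[OF r(1)])
    fix k x y :: "real ^ 'n"
    assume "k \<in> int_lattice" "k \<noteq> 0" "x \<in> K" "y \<in> K"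
    then have "r \<le> dist (y - x) k"
      by (intro r(2)) auto
    also have "dist (y - x) k = norm (k + x - y)"
      by (simp add: dist_norm norm_minus_commute[of "y - x" k] diff_diff_eq2)
    finally show "r \<le> norm (k + x - y)" .
  qed
qed

text \<open>The value of \<open>w\<close> at the lattice point \<open>\<delta>k\<close> is taken on all of \<open>\<delta>(k + K)\<close>. That point need
  not lie in the inclusion, nor in \<open>\<Omega>\<close>, which is why \<open>w\<close> is later defined and Lipschitz on the whole
  space.\<close>

definition cellwise_constant ::
    "(real ^ 'n) set \<Rightarrow> real \<Rightarrow> (real ^ 'n \<Rightarrow> real) \<Rightarrow> real ^ 'n \<Rightarrow> real" where
  "cellwise_constant K \<delta> w x = w (\<delta> *\<^sub>R cell_index K ((1 / \<delta>) *\<^sub>R x))"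

lemma borel_measurable_cellwise_constant:
  assumes "admissible_inclusion K" "w \<in> borel_measurable borel"
  shows "cellwise_constant K \<delta> w \<in> borel_measurable borel"
proof -
  note [measurable] = borel_measurable_cell_index[OF assms(1)] assms(2)
  show ?thesis
    unfolding cellwise_constant_def by measurable
qed

lemma cellwise_constant_close:
  assumes K: "admissible_inclusion K" and D: "\<And>a. a \<in> K \<Longrightarrow> norm a \<le> D" "0 \<le> D"
    and w: "L-lipschitz_on UNIV w" and "\<delta> > 0"
  shows "\<bar>cellwise_constant K \<delta> w x - w x\<bar> \<le> L * (\<delta> * D)"
proof -
  define z where "z = (1 / \<delta>) *\<^sub>R x"
  have x: "x = \<delta> *\<^sub>R z"
    using \<open>\<delta> > 0\<close> by (simp add: z_def)
  have L: "0 \<le> L"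
    using w by (rule lipschitz_on_nonneg)
  have "norm (cell_index K z - z) \<le> D"
  proof (cases "z \<in> periodic_union K")
    case True
    then obtain k where "k \<in> int_lattice" "z - k \<in> K"
      by (auto simp: mem_periodic_union)
    then have "cell_index K z = k" "norm (z - k) \<le> D"
      using cell_index_unique[OF K] D(1) by auto
    then show ?thesis
      by (simp add: norm_minus_commute)
  qed (simp add: cell_index_def D)
  then have "norm (\<delta> *\<^sub>R cell_index K z - x) \<le> \<delta> * D"
    using \<open>\<delta> > 0\<close> by (simp add: x scaleR_diff_right[symmetric])
  then have "L * dist (\<delta> *\<^sub>R cell_index K z) x \<le> L * (\<delta> * D)"
    using L by (intro mult_left_mono) (auto simp: dist_norm)
  then show ?thesis
    using lipschitz_onD[OF w, of "\<delta> *\<^sub>R cell_index K z" x]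
    by (simp add: cellwise_constant_def z_def[symmetric] dist_real_def)
qed

text \<open>The two sampling points \<open>\<delta>k\<close> and \<open>\<delta>l\<close> are at most \<open>|x - y| + 2\<delta>D\<close> apart. Different
  values come from different cells, so \<open>\<delta>r \<le> |x - y|\<close> and the error \<open>2\<delta>D\<close> is at most
  \<open>(2D / r) |x - y|\<close>. The constant does not depend on \<open>\<delta>\<close>.\<close>

lemma cellwise_constant_increment:
  assumes K: "admissible_inclusion K" and D: "\<And>a. a \<in> K \<Longrightarrow> norm a \<le> D" "0 \<le> D"
    and r: "r > 0" "\<And>k a b. k \<in> int_lattice \<Longrightarrow> k \<noteq> 0 \<Longrightarrow> a \<in> K \<Longrightarrow> b \<in> K \<Longrightarrow> r \<le> norm (k + a - b)"
    and w: "L-lipschitz_on UNIV w" and "\<delta> > 0"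
    and x: "x \<in> (*\<^sub>R) \<delta> ` periodic_union K" and y: "y \<in> (*\<^sub>R) \<delta> ` periodic_union K"
    and neq: "cellwise_constant K \<delta> w x \<noteq> cellwise_constant K \<delta> w y"
  shows "\<delta> * r \<le> norm (x - y)"
    "\<bar>cellwise_constant K \<delta> w x - cellwise_constant K \<delta> w y\<bar> \<le> L * (1 + 2 * D / r) * norm (x - y)"
proof -
  obtain k z where k: "k \<in> int_lattice" "z - k \<in> K" and xz: "x = \<delta> *\<^sub>R z"
    using x by (auto simp: mem_periodic_union)
  obtain l z' where l: "l \<in> int_lattice" "z' - l \<in> K" and yz: "y = \<delta> *\<^sub>R z'"
    using y by (auto simp: mem_periodic_union)
  have vx: "cellwise_constant K \<delta> w x = w (\<delta> *\<^sub>R k)" and vy: "cellwise_constant K \<delta> w y = w (\<delta> *\<^sub>R l)"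
    using \<open>\<delta> > 0\<close> cell_index_unique[OF K k] cell_index_unique[OF K l]
    by (auto simp: cellwise_constant_def xz yz)
  have "k - l \<noteq> 0"
    using neq vx vy by auto
  then have "r \<le> norm ((k - l) + (z - k) - (z' - l))"
    using k l by (intro r(2)) (auto intro: int_lattice_diff)
  then have "r \<le> norm (z - z')"
    by simp
  have nxy: "norm (x - y) = \<delta> * norm (z - z')"
    using \<open>\<delta> > 0\<close> by (simp add: xz yz scaleR_diff_right[symmetric])
  show "\<delta> * r \<le> norm (x - y)"
    using \<open>r \<le> norm (z - z')\<close> \<open>\<delta> > 0\<close> nxy by simp
  have "k - l = (z - z') - (z - k) + (z' - l)"
    by simp
  then have "norm (k - l) \<le> norm (z - z') + norm (z - k) + norm (z' - l)"
    using norm_triangle_ineq[of "(z - z') - (z - k)" "z' - l"] norm_triangle_ineq4[of "z - z'" "z - k"]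
    by simp
  also have "\<dots> \<le> norm (z - z') + 2 * D"
    using D(1)[OF k(2)] D(1)[OF l(2)] by linarith
  also have "\<dots> \<le> norm (z - z') + 2 * D * (norm (z - z') / r)"
  proof -
    have "1 \<le> norm (z - z') / r"
      using r \<open>r \<le> norm (z - z')\<close> by simp
    then show ?thesis
      using D(2) mult_left_mono[of 1 "norm (z - z') / r" "2 * D"] by simp
  qed
  also have "\<dots> = (1 + 2 * D / r) * norm (z - z')"
    by (simp add: algebra_simps)
  finally have kl: "norm (k - l) \<le> (1 + 2 * D / r) * norm (z - z')" .
  have "\<bar>w (\<delta> *\<^sub>R k) - w (\<delta> *\<^sub>R l)\<bar> \<le> L * (\<delta> * norm (k - l))"
    using lipschitz_onD[OF w, of "\<delta> *\<^sub>R k" "\<delta> *\<^sub>R l"] \<open>\<delta> > 0\<close>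
    by (simp add: dist_real_def dist_norm scaleR_diff_right[symmetric])
  also have "\<dots> \<le> L * (\<delta> * ((1 + 2 * D / r) * norm (z - z')))"
    using kl \<open>\<delta> > 0\<close> lipschitz_on_nonneg[OF w] by (intro mult_left_mono) auto
  also have "\<dots> = L * (1 + 2 * D / r) * norm (x - y)"
    by (simp add: nxy)
  finally show "\<bar>cellwise_constant K \<delta> w x - cellwise_constant K \<delta> w y\<bar> \<le> L * (1 + 2 * D / r) * norm (x - y)"
    by (simp add: vx vy)
qed

section \<open>Energy and the tail of the second moment\<close>

lemma sigma_finite_lebesgue: "sigma_finite_measure (lebesgue :: 'a::euclidean_space measure)"
proof
  have union: "\<Union>(range (\<lambda>n::nat. cball (0::'a) (real n))) = space lebesgue"
    by (auto simp: real_arch_simple)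
  have finite: "emeasure lebesgue (cball (0::'a) (real n)) \<noteq> \<infinity>" for n
    using emeasure_lborel_cball_finite[of "0::'a" "real n"] by simp
  show "\<exists>A :: 'a set set. countable A \<and> A \<subseteq> sets lebesgue \<and> \<Union>A = space lebesgue \<and>
      (\<forall>a\<in>A. emeasure lebesgue a \<noteq> \<infinity>)"
    by (rule exI[of _ "range (\<lambda>n::nat. cball (0::'a) (real n))"]) (use union finite in auto)
qed

text \<open>This is the substitution \<open>y = x - \<epsilon>\<eta>\<close>. The factor \<open>\<epsilon> ^ DIM('a)\<close> is its Jacobian and
  cancels the normalisation of the scaled kernel.\<close>

lemma nn_integral_reflect_scale:
  fixes h :: "'a::euclidean_space \<Rightarrow> ennreal"
  assumes [measurable]: "h \<in> borel_measurable borel" and "\<epsilon> > 0"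
  shows "(\<integral>\<^sup>+ y. h (x - y) \<partial>lborel) = (\<integral>\<^sup>+ \<eta>. ennreal (\<epsilon> ^ DIM('a)) * h (\<epsilon> *\<^sub>R \<eta>) \<partial>lborel)"
proof -
  have "(\<integral>\<^sup>+ y. h (x - y) \<partial>lborel)
      = (\<integral>\<^sup>+ y. h (x - y) \<partial>density (distr lborel borel (\<lambda>\<eta>. x + (-\<epsilon>) *\<^sub>R \<eta>)) (\<lambda>_. \<bar>-\<epsilon>\<bar> ^ DIM('a)))"
    using \<open>\<epsilon> > 0\<close> by (subst lborel_affine[of "-\<epsilon>" x]) auto
  also have "\<dots> = (\<integral>\<^sup>+ \<eta>. ennreal (\<epsilon> ^ DIM('a)) * h (\<epsilon> *\<^sub>R \<eta>) \<partial>lborel)"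
    using \<open>\<epsilon> > 0\<close> by (subst nn_integral_density) (auto simp: nn_integral_distr)
  finally show ?thesis .
qed

definition second_moment_tail :: "('a::euclidean_space \<Rightarrow> real) \<Rightarrow> real \<Rightarrow> ennreal" where
  "second_moment_tail \<phi> R = (\<integral>\<^sup>+ \<eta>\<in>{\<eta>. R \<le> norm \<eta>}. ennreal (\<phi> \<eta> * (norm \<eta>)\<^sup>2) \<partial>lborel)"

text \<open>Pairs with equal values contribute nothing, and for all others the integrand is at most a function
  \<open>h\<close> of \<open>x - y\<close> that is supported where \<open>|x - y| \<ge> s\<close>. Letting \<open>y\<close> range over the whole space,
  Tonelli's theorem leaves the measure of \<open>\<Omega>\<close> times the integral of \<open>h\<close>, and rescaling by \<open>\<epsilon>\<close>
  produces the factor \<open>\<epsilon>\<^sup>2\<close> that cancels the prefactor of the energy.\<close>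

lemma energy_le_second_moment_tail:
  fixes \<phi> :: "real ^ 'n \<Rightarrow> real"
  assumes \<phi> [measurable]: "\<phi> \<in> borel_measurable borel" and nonneg: "\<And>\<xi>. 0 \<le> \<phi> \<xi>"
    and \<Omega> [measurable]: "\<Omega> \<in> sets lebesgue" and "\<epsilon> > 0"
    and far: "\<And>x y. x \<in> (*\<^sub>R) \<delta> ` E \<Longrightarrow> y \<in> (*\<^sub>R) \<delta> ` E \<Longrightarrow> v x \<noteq> v y \<Longrightarrow> s \<le> norm (x - y)"
    and lip: "\<And>x y. x \<in> (*\<^sub>R) \<delta> ` E \<Longrightarrow> y \<in> (*\<^sub>R) \<delta> ` E \<Longrightarrow> v x \<noteq> v y \<Longrightarrow> \<bar>v x - v y\<bar> \<le> C * norm (x - y)"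
  shows "energy \<phi> \<Omega> E \<delta> \<epsilon> v \<le> ennreal (C\<^sup>2) * emeasure lebesgue \<Omega> * second_moment_tail \<phi> (s / \<epsilon>)"
proof -
  interpret leb: sigma_finite_measure "lebesgue :: (real ^ 'n) measure"
    by (rule sigma_finite_lebesgue)
  define h where "h \<xi> = ennreal (scaled_kernel \<phi> \<epsilon> \<xi> * (C\<^sup>2 * (norm \<xi>)\<^sup>2)) * indicator {\<xi>. s \<le> norm \<xi>} \<xi>" for \<xi>
  have kernel_nonneg: "0 \<le> scaled_kernel \<phi> \<epsilon> \<xi>" for \<xi>
    using nonneg \<open>\<epsilon> > 0\<close> by (simp add: scaled_kernel_def)
  have h [measurable]: "h \<in> borel_measurable borel"
    unfolding h_def scaled_kernel_def by measurable
  have id [measurable]: "(\<lambda>x. x) \<in> lebesgue \<rightarrow>\<^sub>M (borel :: (real ^ 'n) measure)"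
    by (simp add: measurable_completion)
  \<comment> \<open>Each projection factors through the identity from the completed to the Borel measure, so that
    Borel functions of \<open>x - y\<close> are measurable for the product of the completed measures.\<close>
  have [measurable]: "fst \<in> borel_measurable ((lebesgue :: (real ^ 'n) measure) \<Otimes>\<^sub>M (lebesgue :: (real ^ 'n) measure))"
    by (rule measurable_compose[OF measurable_fst id])
  have [measurable]: "snd \<in> borel_measurable ((lebesgue :: (real ^ 'n) measure) \<Otimes>\<^sub>M (lebesgue :: (real ^ 'n) measure))"
    by (rule measurable_compose[OF measurable_snd id])
  let ?A = "\<Omega> \<inter> (*\<^sub>R) \<delta> ` E"
  have "(\<integral>\<^sup>+ (x, y) \<in> ?A \<times> ?A. ennreal (scaled_kernel \<phi> \<epsilon> (x - y) * \<bar>v x - v y\<bar>\<^sup>2) \<partial>(lebesgue \<Otimes>\<^sub>M lebesgue))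
      \<le> (\<integral>\<^sup>+ p. indicator \<Omega> (fst p) * h (fst p - snd p) \<partial>(lebesgue \<Otimes>\<^sub>M lebesgue))"
  proof (rule nn_integral_mono, clarify)
    fix x y
    show "ennreal (scaled_kernel \<phi> \<epsilon> (x - y) * \<bar>v x - v y\<bar>\<^sup>2) * indicator (?A \<times> ?A) (x, y)
        \<le> indicator \<Omega> (fst (x, y)) * h (fst (x, y) - snd (x, y))"
    proof (cases "(x, y) \<in> ?A \<times> ?A \<and> v x \<noteq> v y")
      case True
      then have "s \<le> norm (x - y)" "\<bar>v x - v y\<bar> \<le> C * norm (x - y)" "x \<in> \<Omega>"
        using far lip by auto
      moreover have "\<bar>v x - v y\<bar>\<^sup>2 \<le> (C * norm (x - y))\<^sup>2"
        using calculation(2) by (intro power_mono) auto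
      ultimately show ?thesis
        using True kernel_nonneg
        by (auto simp: h_def power_mult_distrib intro!: ennreal_leI mult_left_mono)
    qed auto
  qed
  also have "\<dots> = (\<integral>\<^sup>+ x. \<integral>\<^sup>+ y. indicator \<Omega> x * h (x - y) \<partial>lebesgue \<partial>lebesgue)"
    by (subst leb.nn_integral_fst[symmetric]) auto
  also have "\<dots> = (\<integral>\<^sup>+ x. (\<integral>\<^sup>+ \<eta>. ennreal (\<epsilon> ^ CARD('n)) * h (\<epsilon> *\<^sub>R \<eta>) \<partial>lborel) * indicator \<Omega> x \<partial>lebesgue)"
    using nn_integral_reflect_scale[OF h \<open>\<epsilon> > 0\<close>]
    by (simp add: nn_integral_cmult nn_integral_completion mult.commute)
  also have "\<dots> = (\<integral>\<^sup>+ \<eta>. ennreal (\<epsilon> ^ CARD('n)) * h (\<epsilon> *\<^sub>R \<eta>) \<partial>lborel) * emeasure lebesgue \<Omega>"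
    by (rule nn_integral_cmult_indicator) simp
  also have "(\<integral>\<^sup>+ \<eta>. ennreal (\<epsilon> ^ CARD('n)) * h (\<epsilon> *\<^sub>R \<eta>) \<partial>lborel)
      = (\<integral>\<^sup>+ \<eta>. ennreal (C\<^sup>2 * \<epsilon>\<^sup>2) * (ennreal (\<phi> \<eta> * (norm \<eta>)\<^sup>2) * indicator {\<eta>. s / \<epsilon> \<le> norm \<eta>} \<eta>) \<partial>lborel)"
  proof (rule nn_integral_cong)
    fix \<eta> :: "real ^ 'n"
    have "\<epsilon> ^ CARD('n) * (scaled_kernel \<phi> \<epsilon> (\<epsilon> *\<^sub>R \<eta>) * (C\<^sup>2 * (norm (\<epsilon> *\<^sub>R \<eta>))\<^sup>2))
        = C\<^sup>2 * \<epsilon>\<^sup>2 * (\<phi> \<eta> * (norm \<eta>)\<^sup>2)"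
      using \<open>\<epsilon> > 0\<close> by (simp add: scaled_kernel_def power_mult_distrib)
    moreover have "s \<le> norm (\<epsilon> *\<^sub>R \<eta>) \<longleftrightarrow> s / \<epsilon> \<le> norm \<eta>"
      using \<open>\<epsilon> > 0\<close> by (simp add: field_simps)
    ultimately show "ennreal (\<epsilon> ^ CARD('n)) * h (\<epsilon> *\<^sub>R \<eta>)
        = ennreal (C\<^sup>2 * \<epsilon>\<^sup>2) * (ennreal (\<phi> \<eta> * (norm \<eta>)\<^sup>2) * indicator {\<eta>. s / \<epsilon> \<le> norm \<eta>} \<eta>)"
      unfolding h_def using \<open>\<epsilon> > 0\<close> kernel_nonneg nonneg
      by (auto simp: ennreal_mult[symmetric] split: split_indicator)
  qed
  also have "\<dots> = ennreal (C\<^sup>2 * \<epsilon>\<^sup>2) * second_moment_tail \<phi> (s / \<epsilon>)"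
    unfolding second_moment_tail_def by (rule nn_integral_cmult) auto
  finally have "energy \<phi> \<Omega> E \<delta> \<epsilon> v
      \<le> ennreal (1 / \<epsilon>\<^sup>2) * (ennreal (C\<^sup>2 * \<epsilon>\<^sup>2) * second_moment_tail \<phi> (s / \<epsilon>) * emeasure lebesgue \<Omega>)"
    unfolding energy_def by (rule mult_left_mono) simp
  also have "\<dots> = (ennreal (1 / \<epsilon>\<^sup>2) * ennreal (C\<^sup>2 * \<epsilon>\<^sup>2)) * emeasure lebesgue \<Omega> * second_moment_tail \<phi> (s / \<epsilon>)"
    by (simp only: mult_ac)
  also have "ennreal (1 / \<epsilon>\<^sup>2) * ennreal (C\<^sup>2 * \<epsilon>\<^sup>2) = ennreal (C\<^sup>2)"
    using \<open>\<epsilon> > 0\<close> by (simp add: ennreal_mult[symmetric])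
  finally show ?thesis .
qed

lemma second_moment_tail_tendsto_zero:
  fixes \<phi> :: "'a::euclidean_space \<Rightarrow> real"
  assumes \<phi> [measurable]: "\<phi> \<in> borel_measurable borel" and nonneg: "\<And>\<xi>. 0 \<le> \<phi> \<xi>"
    and int: "integrable lebesgue (\<lambda>\<xi>. \<phi> \<xi> * (1 + (norm \<xi>)\<^sup>2))"
  shows "(second_moment_tail \<phi> \<longlongrightarrow> 0) at_top"
proof (rule tendsto_at_topI_sequentially)
  fix X :: "nat \<Rightarrow> real" assume X: "filterlim X at_top sequentially"
  have "(\<integral>\<^sup>+ \<xi>. ennreal (\<phi> \<xi> * (1 + (norm \<xi>)\<^sup>2)) \<partial>lebesgue) < \<infinity>"
    using integrableD(2)[OF int] nonneg by (simp add: less_top)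
  then have fin: "(\<integral>\<^sup>+ \<xi>. ennreal (\<phi> \<xi> * (1 + (norm \<xi>)\<^sup>2)) \<partial>lborel) < \<infinity>"
    by (simp add: nn_integral_completion)
  have "(\<lambda>n. \<integral>\<^sup>+ \<eta>. ennreal (\<phi> \<eta> * (norm \<eta>)\<^sup>2) * indicator {\<eta>. X n \<le> norm \<eta>} \<eta> \<partial>lborel)
      \<longlonglongrightarrow> (\<integral>\<^sup>+ \<eta>. 0 \<partial>(lborel :: 'a measure))"
  proof (rule nn_integral_dominated_convergence[OF _ _ _ _ fin])
    show "AE \<eta> in lborel. ennreal (\<phi> \<eta> * (norm \<eta>)\<^sup>2) * indicator {\<eta>. X n \<le> norm \<eta>} \<eta>
        \<le> ennreal (\<phi> \<eta> * (1 + (norm \<eta>)\<^sup>2))" for n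
      using nonneg by (auto split: split_indicator intro!: ennreal_leI mult_left_mono)
    have "(\<lambda>n. ennreal (\<phi> \<eta> * (norm \<eta>)\<^sup>2) * indicator {\<eta>. X n \<le> norm \<eta>} \<eta>) \<longlonglongrightarrow> 0" for \<eta>
    proof (rule tendsto_eventually)
      show "eventually (\<lambda>n. ennreal (\<phi> \<eta> * (norm \<eta>)\<^sup>2) * indicator {\<eta>. X n \<le> norm \<eta>} \<eta> = 0) sequentially"
        using filterlim_at_top_dense[THEN iffD1, OF X, rule_format, of "norm \<eta>"]
        by eventually_elim auto
    qed
    then show "AE \<eta> in lborel. (\<lambda>n. ennreal (\<phi> \<eta> * (norm \<eta>)\<^sup>2) * indicator {\<eta>. X n \<le> norm \<eta>} \<eta>) \<longlonglongrightarrow> 0"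
      by simp
  qed auto
  then show "(\<lambda>n. second_moment_tail \<phi> (X n)) \<longlonglongrightarrow> 0"
    by (simp add: second_moment_tail_def)
qed

text \<open>A monotone profile is Borel, and composing it with the norm keeps this. The profile is
  monotone only on \<open>[0, \<infinity>)\<close>, so it is extended constantly to the left by \<open>max 0 r\<close>.\<close>

lemma radial_decreasing_kernelD:
  assumes "radial_decreasing_kernel \<phi>"
  shows "\<phi> \<in> borel_measurable borel" "0 \<le> \<phi> \<xi>" "integrable lebesgue (\<lambda>\<xi>. \<phi> \<xi> * (1 + (norm \<xi>)\<^sup>2))"
proof -
  obtain \<phi>0 where nonneg: "\<And>r. r \<ge> 0 \<Longrightarrow> 0 \<le> \<phi>0 r" and anti: "antimono_on {0..} \<phi>0"
      and \<phi>: "\<And>\<xi>. \<phi> \<xi> = \<phi>0 (norm \<xi>)"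
    using assms unfolding radial_decreasing_kernel_def by blast
  have "mono (\<lambda>r. - \<phi>0 (max 0 r))"
    using anti by (auto simp: mono_def monotone_on_def)
  then have [measurable]: "(\<lambda>r. - \<phi>0 (max 0 r)) \<in> borel_measurable borel"
    by (rule borel_measurable_mono)
  have "(\<lambda>\<xi>::real^'a. - (- \<phi>0 (max 0 (norm \<xi>)))) \<in> borel_measurable borel"
    by measurable
  then show "\<phi> \<in> borel_measurable borel"
    by (simp add: \<phi>[abs_def])
  show "0 \<le> \<phi> \<xi>"
    by (simp add: \<phi> nonneg)
  show "integrable lebesgue (\<lambda>\<xi>. \<phi> \<xi> * (1 + (norm \<xi>)\<^sup>2))"
    using assms unfolding radial_decreasing_kernel_def by blast
qed

section \<open>Recovery by cellwise constant functions\<close>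

lemma cellwise_constant_tendsto:
  fixes K \<Omega> :: "(real ^ 'n) set"
  assumes K: "admissible_inclusion K" and w: "bounded_lipschitz w"
    and \<Omega>: "\<Omega> \<in> sets lebesgue" "emeasure lebesgue \<Omega> < \<infinity>"
    and pos: "\<And>\<epsilon>. \<epsilon> > 0 \<Longrightarrow> \<delta> \<epsilon> > 0" and lim: "(\<delta> \<longlongrightarrow> 0) (at_right 0)"
  shows "((\<lambda>\<epsilon>. sq_dist \<Omega> (cellwise_constant K (\<delta> \<epsilon>) w) w) \<longlongrightarrow> 0) (at_right 0)"
proof -
  obtain D where D: "\<And>a. a \<in> K \<Longrightarrow> norm a \<le> D" "0 \<le> D"
    using K unfolding admissible_inclusion_def
    by (meson compact_imp_bounded bounded_pos less_imp_le)
  obtain L where L: "L-lipschitz_on UNIV w"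
    using w unfolding bounded_lipschitz_def by auto
  have "((\<lambda>\<epsilon>. (L * (\<delta> \<epsilon> * D))\<^sup>2) \<longlongrightarrow> (L * (0 * D))\<^sup>2) (at_right 0)"
    by (intro tendsto_intros lim)
  then have "((\<lambda>\<epsilon>. ennreal ((L * (\<delta> \<epsilon> * D))\<^sup>2)) \<longlongrightarrow> ennreal 0) (at_right 0)"
    by (intro tendsto_ennrealI) simp
  then have "((\<lambda>\<epsilon>. emeasure lebesgue \<Omega> * ennreal ((L * (\<delta> \<epsilon> * D))\<^sup>2)) \<longlongrightarrow> emeasure lebesgue \<Omega> * ennreal 0) (at_right 0)"
    using \<Omega>(2) by (intro ennreal_tendsto_cmult) auto
  then have upper: "((\<lambda>\<epsilon>. ennreal ((L * (\<delta> \<epsilon> * D))\<^sup>2) * emeasure lebesgue \<Omega>) \<longlongrightarrow> 0) (at_right 0)"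
    by (simp add: mult.commute)
  show ?thesis
  proof (rule tendsto_sandwich[OF _ _ tendsto_const upper])
    show "\<forall>\<^sub>F \<epsilon> in at_right 0. sq_dist \<Omega> (cellwise_constant K (\<delta> \<epsilon>) w) w
        \<le> ennreal ((L * (\<delta> \<epsilon> * D))\<^sup>2) * emeasure lebesgue \<Omega>"
      unfolding eventually_at_filter
      by (intro always_eventually allI impI sq_dist_le_uniform \<Omega> cellwise_constant_close K D L pos) auto
  qed simp
qed

lemma cellwise_constant_energy_tendsto:
  fixes K \<Omega> :: "(real ^ 'n) set"
  assumes \<phi>: "radial_decreasing_kernel \<phi>" and K: "admissible_inclusion K" and w: "bounded_lipschitz w"
    and \<Omega>: "\<Omega> \<in> sets lebesgue" "emeasure lebesgue \<Omega> < \<infinity>"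
    and pos: "\<And>\<epsilon>. \<epsilon> > 0 \<Longrightarrow> \<delta> \<epsilon> > 0" and lim: "((\<lambda>\<epsilon>. \<epsilon> / \<delta> \<epsilon>) \<longlongrightarrow> 0) (at_right 0)"
  shows "((\<lambda>\<epsilon>. energy \<phi> \<Omega> (periodic_union K) (\<delta> \<epsilon>) \<epsilon> (cellwise_constant K (\<delta> \<epsilon>) w)) \<longlongrightarrow> 0) (at_right 0)"
proof -
  obtain D where D: "\<And>a. a \<in> K \<Longrightarrow> norm a \<le> D" "0 \<le> D"
    using K unfolding admissible_inclusion_def
    by (meson compact_imp_bounded bounded_pos less_imp_le)
  obtain L where L: "L-lipschitz_on UNIV w"
    using w unfolding bounded_lipschitz_def by auto
  obtain r where r: "r > 0"
    "\<And>k a b. k \<in> int_lattice \<Longrightarrow> k \<noteq> 0 \<Longrightarrow> a \<in> K \<Longrightarrow> b \<in> K \<Longrightarrow> r \<le> norm (k + a - b)"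
    using cells_separated[OF K] by metis
  define C where "C = L * (1 + 2 * D / r)"
  have pos': "eventually (\<lambda>\<epsilon>. \<epsilon> > (0::real)) (at_right 0)"
    by (simp add: eventually_at_right_less)
  \<comment> \<open>Scale separation enters here: the distance between cells, measured in units of \<open>\<epsilon>\<close>, diverges.\<close>
  have "filterlim (\<lambda>\<epsilon>. inverse (\<epsilon> / \<delta> \<epsilon>)) at_top (at_right 0)"
    using lim by (rule filterlim_inverse_at_top)
      (use pos' in eventually_elim, auto simp: pos)
  then have "filterlim (\<lambda>\<epsilon>. r * inverse (\<epsilon> / \<delta> \<epsilon>)) at_top (at_right 0)"
    using r(1) by (intro filterlim_tendsto_pos_mult_at_top[OF tendsto_const])
  then have "filterlim (\<lambda>\<epsilon>. \<delta> \<epsilon> * r / \<epsilon>) at_top (at_right 0)"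
    by (simp add: field_simps)
  with second_moment_tail_tendsto_zero[OF radial_decreasing_kernelD[OF \<phi>]]
  have "((\<lambda>\<epsilon>. second_moment_tail \<phi> (\<delta> \<epsilon> * r / \<epsilon>)) \<longlongrightarrow> 0) (at_right 0)"
    by (rule filterlim_compose)
  then have "((\<lambda>\<epsilon>. (ennreal (C\<^sup>2) * emeasure lebesgue \<Omega>) * second_moment_tail \<phi> (\<delta> \<epsilon> * r / \<epsilon>))
      \<longlongrightarrow> (ennreal (C\<^sup>2) * emeasure lebesgue \<Omega>) * 0) (at_right 0)"
    using \<Omega>(2) by (intro ennreal_tendsto_cmult) (auto simp: ennreal_mult_less_top)
  then have upper: "((\<lambda>\<epsilon>. ennreal (C\<^sup>2) * emeasure lebesgue \<Omega> * second_moment_tail \<phi> (\<delta> \<epsilon> * r / \<epsilon>)) \<longlongrightarrow> 0) (at_right 0)"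
    by simp
  show ?thesis
  proof (rule tendsto_sandwich[OF _ _ tendsto_const upper])
    show "\<forall>\<^sub>F \<epsilon> in at_right 0. energy \<phi> \<Omega> (periodic_union K) (\<delta> \<epsilon>) \<epsilon> (cellwise_constant K (\<delta> \<epsilon>) w)
        \<le> ennreal (C\<^sup>2) * emeasure lebesgue \<Omega> * second_moment_tail \<phi> (\<delta> \<epsilon> * r / \<epsilon>)"
      using pos'
    proof eventually_elim
      fix \<epsilon> :: real assume "\<epsilon> > 0"
      then have "\<delta> \<epsilon> > 0"
        by (rule pos)
      show "energy \<phi> \<Omega> (periodic_union K) (\<delta> \<epsilon>) \<epsilon> (cellwise_constant K (\<delta> \<epsilon>) w)
          \<le> ennreal (C\<^sup>2) * emeasure lebesgue \<Omega> * second_moment_tail \<phi> (\<delta> \<epsilon> * r / \<epsilon>)"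
        using \<phi> \<Omega>(1) \<open>\<epsilon> > 0\<close>
        by (intro energy_le_second_moment_tail radial_decreasing_kernelD)
          (auto simp: C_def simp del: neq_iff intro: cellwise_constant_increment[OF K D r L \<open>\<delta> \<epsilon> > 0\<close>])
    qed
  qed simp
qed

lemma L2_on_bounded:
  fixes \<Omega> :: "(real ^ 'n) set"
  assumes [measurable]: "v \<in> borel_measurable lebesgue" "\<Omega> \<in> sets lebesgue"
    and fin: "emeasure lebesgue \<Omega> < \<infinity>" and B: "\<And>x. \<bar>v x\<bar> \<le> B"
  shows "L2_on \<Omega> v"
proof -
  have "integrable lebesgue (\<lambda>x. indicator \<Omega> x *\<^sub>R (v x)\<^sup>2)"
  proof (rule Bochner_Integration.integrable_bound[of _ "\<lambda>x. indicator \<Omega> x * B\<^sup>2"])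
    show "integrable lebesgue (\<lambda>x. indicator \<Omega> x * B\<^sup>2)"
      using fin by (intro integrable_mult_left integrable_real_indicator) auto
    have "(v x)\<^sup>2 \<le> B\<^sup>2" for x
      using B[of x] by (intro abs_le_square_iff[THEN iffD1]) auto
    then show "AE x in lebesgue. norm (indicator \<Omega> x *\<^sub>R (v x)\<^sup>2) \<le> norm (indicator \<Omega> x * B\<^sup>2)"
      by (auto split: split_indicator)
  qed auto
  then show ?thesis
    unfolding L2_on_def set_borel_measurable_def set_integrable_def by auto
qed

lemma L2_dist_on_eq_sqrt_sq_dist:
  assumes "L2_on \<Omega> v" "L2_on \<Omega> u"
  shows "L2_dist_on \<Omega> v u = sqrt (enn2real (sq_dist \<Omega> v u))"
proof -
  have [measurable]: "(\<lambda>x. indicator \<Omega> x *\<^sub>R v x) \<in> borel_measurable lebesgue"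
      "(\<lambda>x. indicator \<Omega> x *\<^sub>R u x) \<in> borel_measurable lebesgue"
    using assms by (auto simp: L2_on_def set_borel_measurable_def)
  have eq: "indicator \<Omega> x *\<^sub>R (v x - u x)\<^sup>2 = (indicator \<Omega> x *\<^sub>R v x - indicator \<Omega> x *\<^sub>R u x)\<^sup>2" for x
    by (simp split: split_indicator)
  have "(\<lambda>x. indicator \<Omega> x *\<^sub>R (v x - u x)\<^sup>2) \<in> borel_measurable lebesgue"
    unfolding eq by measurable
  then have "(LINT x:\<Omega>|lebesgue. (v x - u x)\<^sup>2)
      = enn2real (\<integral>\<^sup>+ x. ennreal (indicator \<Omega> x *\<^sub>R (v x - u x)\<^sup>2) \<partial>lebesgue)"
    unfolding set_lebesgue_integral_def by (rule integral_eq_nn_integral) auto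
  also have "(\<integral>\<^sup>+ x. ennreal (indicator \<Omega> x *\<^sub>R (v x - u x)\<^sup>2) \<partial>lebesgue) = sq_dist \<Omega> v u"
    unfolding sq_dist_def by (intro nn_integral_cong) (auto split: split_indicator)
  finally show ?thesis
    by (simp add: L2_dist_on_def)
qed

text \<open>The hypothesis allows the competitor to depend on \<open>e\<close> in an arbitrary way, but it only says that
  the infimum of \<open>c \<epsilon>\<close> tends to zero. The infimum need not be attained, so a slack is granted;
  \<open>\<epsilon>\<close> itself serves, since it is positive and tends to zero.\<close>

lemma near_minimizers_tendsto_zero:
  fixes c :: "real \<Rightarrow> 'a \<Rightarrow> ennreal"
  assumes "P v0"
    and small: "\<And>e. e > (0::real) \<Longrightarrow> \<forall>\<^sub>F \<epsilon> in at_right 0. \<exists>v. P v \<and> c \<epsilon> v < ennreal e"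
  obtains f where "\<And>\<epsilon>. \<epsilon> > 0 \<Longrightarrow> P (f \<epsilon>)" "((\<lambda>\<epsilon>. c \<epsilon> (f \<epsilon>)) \<longlongrightarrow> 0) (at_right 0)"
proof -
  define m where "m \<epsilon> = (INF v\<in>Collect P. c \<epsilon> v)" for \<epsilon>
  have "\<exists>v. P v \<and> c \<epsilon> v \<le> m \<epsilon> + ennreal \<epsilon>" if "\<epsilon> > 0" for \<epsilon>
  proof (cases "m \<epsilon> = \<infinity>")
    case True
    then show ?thesis
      using \<open>P v0\<close> by auto
  next
    case False
    then have "m \<epsilon> < m \<epsilon> + ennreal \<epsilon>"
      using that by (metis ennreal_add_left_cancel_less add.right_neutral ennreal_less_zero_iff infinity_ennreal_def)
    then obtain v where "P v" "c \<epsilon> v < m \<epsilon> + ennreal \<epsilon>"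
      unfolding m_def[of \<epsilon>] INF_less_iff by auto
    then show ?thesis
      by (auto intro: less_imp_le)
  qed
  then obtain f where f: "\<And>\<epsilon>. \<epsilon> > 0 \<Longrightarrow> P (f \<epsilon>)" "\<And>\<epsilon>. \<epsilon> > 0 \<Longrightarrow> c \<epsilon> (f \<epsilon>) \<le> m \<epsilon> + ennreal \<epsilon>"
    by metis
  have "(m \<longlongrightarrow> 0) (at_right 0)"
  proof (rule order_tendstoI)
    fix a :: ennreal assume "0 < a"
    then obtain b where b: "0 < b" "b < a"
      using dense by blast
    then obtain e where e: "b = ennreal e" "e > 0"
      by (cases b) auto
    show "\<forall>\<^sub>F \<epsilon> in at_right 0. m \<epsilon> < a"
      using small[OF e(2)]
    proof eventually_elim
      fix \<epsilon> assume "\<exists>v. P v \<and> c \<epsilon> v < ennreal e"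
      then show "m \<epsilon> < a"
        unfolding m_def INF_less_iff using b e by (auto intro: less_trans)
    qed
  qed simp
  moreover have "(ennreal \<longlongrightarrow> ennreal 0) (at_right 0)"
    by (intro tendsto_ennrealI tendsto_ident_at)
  ultimately have upper: "((\<lambda>\<epsilon>. m \<epsilon> + ennreal \<epsilon>) \<longlongrightarrow> 0) (at_right 0)"
    using tendsto_add[of m 0 "at_right 0" ennreal "ennreal 0"] by simp
  have "((\<lambda>\<epsilon>. c \<epsilon> (f \<epsilon>)) \<longlongrightarrow> 0) (at_right 0)"
  proof (rule tendsto_sandwich[OF _ _ tendsto_const upper])
    show "\<forall>\<^sub>F \<epsilon> in at_right 0. c \<epsilon> (f \<epsilon>) \<le> m \<epsilon> + ennreal \<epsilon>"
      using eventually_at_right_less[of "0::real"] by eventually_elim (rule f(2))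
  qed simp
  with f(1) show ?thesis
    using that by blast
qed

theorem theorem2p2:
  fixes \<phi> :: "real ^ 'n \<Rightarrow> real"
    and \<Omega> K :: "(real ^ 'n) set"
    and \<delta> :: "real \<Rightarrow> real"
    and u :: "real ^ 'n \<Rightarrow> real"
  assumes "radial_decreasing_kernel \<phi>"
    and "bounded_lipschitz_domain \<Omega>"
    and "admissible_inclusion K"
    and "\<And>\<epsilon>. \<epsilon> > 0 \<Longrightarrow> \<delta> \<epsilon> > 0"
    and "(\<delta> \<longlongrightarrow> 0) (at_right 0)"
    and "((\<lambda>\<epsilon>. \<epsilon> / \<delta> \<epsilon>) \<longlongrightarrow> 0) (at_right 0)"
    and "L2_on \<Omega> u"
  shows "\<exists>u\<epsilon> :: real \<Rightarrow> real ^ 'n \<Rightarrow> real.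
           (\<forall>\<epsilon>>0. L2_on \<Omega> (u\<epsilon> \<epsilon>)) \<and>
           ((\<lambda>\<epsilon>. L2_dist_on \<Omega> (u\<epsilon> \<epsilon>) u) \<longlongrightarrow> 0) (at_right 0) \<and>
           ((\<lambda>\<epsilon>. energy \<phi> \<Omega> (periodic_union K) (\<delta> \<epsilon>) \<epsilon> (u\<epsilon> \<epsilon>)) \<longlongrightarrow> 0) (at_right 0)"
proof -
  let ?F = "\<lambda>\<epsilon>. energy \<phi> \<Omega> (periodic_union K) (\<delta> \<epsilon>) \<epsilon>"
  have "open \<Omega>" "bounded \<Omega>"
    using assms(2) by (auto simp: bounded_lipschitz_domain_def)
  then have \<Omega> [measurable]: "\<Omega> \<in> sets lebesgue"
    by simp
  have fin: "emeasure lebesgue \<Omega> < \<infinity>"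
    using bounded_set_imp_lmeasurable[OF \<open>bounded \<Omega>\<close> \<Omega>] by (simp add: fmeasurable_def)
  \<comment> \<open>Only the product of \<open>u\<close> with the indicator of \<open>\<Omega>\<close> is known to be measurable.\<close>
  define U where "U x = indicator \<Omega> x *\<^sub>R u x" for x
  have U [measurable]: "U \<in> borel_measurable lebesgue"
    using assms(7) unfolding U_def[abs_def] L2_on_def set_borel_measurable_def by auto
  have "integrable lebesgue (\<lambda>x. indicator \<Omega> x *\<^sub>R (u x)\<^sup>2)"
    using assms(7) by (auto simp: L2_on_def set_integrable_def)
  from integrableD(2)[OF this]
  have "(\<integral>\<^sup>+ x. ennreal (norm (indicator \<Omega> x *\<^sub>R (u x)\<^sup>2)) \<partial>lebesgue) < \<infinity>"
    by (simp add: less_top)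
  also have "(\<integral>\<^sup>+ x. ennreal (norm (indicator \<Omega> x *\<^sub>R (u x)\<^sup>2)) \<partial>lebesgue)
      = (\<integral>\<^sup>+ x\<in>\<Omega>. ennreal ((U x)\<^sup>2) \<partial>lebesgue)"
    by (intro nn_integral_cong) (auto simp: U_def split: split_indicator)
  finally have U_fin: "(\<integral>\<^sup>+ x\<in>\<Omega>. ennreal ((U x)\<^sup>2) \<partial>lebesgue) < \<infinity>" .
  have sq_dist_U: "sq_dist \<Omega> v u = sq_dist \<Omega> v U" for v
    by (rule sq_dist_cong) (auto simp: U_def)
  have "\<forall>\<^sub>F \<epsilon> in at_right 0. \<exists>v. L2_on \<Omega> v \<and> sq_dist \<Omega> v u + ?F \<epsilon> v < ennreal e" if "e > 0" for e :: real
  proof -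
    obtain w where w: "bounded_lipschitz w" and w_U: "sq_dist \<Omega> w U < ennreal (e / 8)"
      using bounded_lipschitz_dense[OF U \<Omega> \<open>bounded \<Omega>\<close> U_fin, of "e / 8"] \<open>e > 0\<close> by auto
    have sum: "2 * ennreal a + 2 * ennreal b + ennreal c = ennreal (2 * a + 2 * b + c)"
      if "0 \<le> a" "0 \<le> b" "0 \<le> c" for a b c
      using that by (simp add: ennreal_plus ennreal_mult)
    let ?v = "\<lambda>\<epsilon>. cellwise_constant K (\<delta> \<epsilon>) w"
    have [measurable]: "w \<in> borel_measurable lebesgue" "?v \<epsilon> \<in> borel_measurable lebesgue" for \<epsilon>
      using bounded_lipschitz_borel[OF w] borel_measurable_cellwise_constant[OF assms(3), of w]
      by (simp_all add: measurable_completion)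
    obtain B where "\<And>x. \<bar>w x\<bar> \<le> B"
      using w by (auto simp: bounded_lipschitz_def bounded_iff)
    then have v_L2: "L2_on \<Omega> (?v \<epsilon>)" for \<epsilon>
      by (intro L2_on_bounded[of _ _ B] fin) (auto simp: cellwise_constant_def)
    have "\<forall>\<^sub>F \<epsilon> in at_right 0. sq_dist \<Omega> (?v \<epsilon>) w < ennreal (e / 8)"
      using \<open>e > 0\<close>
      by (intro order_tendstoD(2)[OF cellwise_constant_tendsto[OF assms(3) w \<Omega> fin assms(4,5)]]) auto
    moreover have "\<forall>\<^sub>F \<epsilon> in at_right 0. ?F \<epsilon> (?v \<epsilon>) < ennreal (e / 8)"
      using \<open>e > 0\<close>
      by (intro order_tendstoD(2)[OF cellwise_constant_energy_tendsto[OF assms(1,3) w \<Omega> fin assms(4,6)]]) auto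
    ultimately show ?thesis
    proof eventually_elim
      fix \<epsilon>
      assume v_w: "sq_dist \<Omega> (?v \<epsilon>) w < ennreal (e / 8)" and energy: "?F \<epsilon> (?v \<epsilon>) < ennreal (e / 8)"
      have "sq_dist \<Omega> (?v \<epsilon>) u + ?F \<epsilon> (?v \<epsilon>)
          \<le> (2 * sq_dist \<Omega> (?v \<epsilon>) w + 2 * sq_dist \<Omega> w U) + ?F \<epsilon> (?v \<epsilon>)"
        unfolding sq_dist_U by (intro add_right_mono sq_dist_triangle) auto
      also have "\<dots> \<le> (2 * ennreal (e / 8) + 2 * ennreal (e / 8)) + ennreal (e / 8)"
        using v_w w_U energy by (intro add_mono mult_left_mono) auto
      also have "\<dots> = ennreal (2 * (e / 8) + 2 * (e / 8) + e / 8)"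
        using \<open>e > 0\<close> by (intro sum) auto
      also have "\<dots> < ennreal e"
        using \<open>e > 0\<close> by (simp add: ennreal_lessI)
      finally show "\<exists>v. L2_on \<Omega> v \<and> sq_dist \<Omega> v u + ?F \<epsilon> v < ennreal e"
        using v_L2 by blast
    qed
  qed
  then obtain u\<epsilon> where L2: "\<And>\<epsilon>. \<epsilon> > 0 \<Longrightarrow> L2_on \<Omega> (u\<epsilon> \<epsilon>)"
    and lim: "((\<lambda>\<epsilon>. sq_dist \<Omega> (u\<epsilon> \<epsilon>) u + ?F \<epsilon> (u\<epsilon> \<epsilon>)) \<longlongrightarrow> 0) (at_right 0)"
    using near_minimizers_tendsto_zero[of "L2_on \<Omega>" u "\<lambda>\<epsilon> v. sq_dist \<Omega> v u + ?F \<epsilon> v"] assms(7)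
    by blast
  have "((\<lambda>\<epsilon>. sq_dist \<Omega> (u\<epsilon> \<epsilon>) u) \<longlongrightarrow> 0) (at_right 0)"
    by (rule tendsto_sandwich[OF _ _ tendsto_const lim]) auto
  then have "((\<lambda>\<epsilon>. sqrt (enn2real (sq_dist \<Omega> (u\<epsilon> \<epsilon>) u))) \<longlongrightarrow> sqrt (enn2real 0)) (at_right 0)"
    by (intro tendsto_intros) (auto intro: tendsto_enn2real)
  moreover have "\<forall>\<^sub>F \<epsilon> in at_right 0. L2_dist_on \<Omega> (u\<epsilon> \<epsilon>) u = sqrt (enn2real (sq_dist \<Omega> (u\<epsilon> \<epsilon>) u))"
    using eventually_at_right_less[of "0::real"]
    by eventually_elim (rule L2_dist_on_eq_sqrt_sq_dist[OF L2 assms(7)])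
  ultimately have "((\<lambda>\<epsilon>. L2_dist_on \<Omega> (u\<epsilon> \<epsilon>) u) \<longlongrightarrow> 0) (at_right 0)"
    by (simp add: tendsto_cong)
  moreover have "((\<lambda>\<epsilon>. ?F \<epsilon> (u\<epsilon> \<epsilon>)) \<longlongrightarrow> 0) (at_right 0)"
    by (rule tendsto_sandwich[OF _ _ tendsto_const lim]) auto
  ultimately show ?thesis
    using L2 by blast
qed

end
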